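(* Let $M,P,N_s,n\ge 1$ be integers and let $p(\mathbf Y,\mathbf z)$ be any probability distribution on $\mathbb{R}^{P\times N_s}\times\{0,1\}^M$. Let $\mathbf f=(f_1,\dots,f_M):\mathbb{R}^{P\times N_s}\to[0,\infty)^M$ be any fixed (measurable) feature extractor. Assume that the $n=|\mathcal D^{\rm cal}|$ calibration samples $\mathcal D^{\rm cal}=\{(\mathbf Y_i^{\rm cal},\mathbf z_i^{\rm cal})\}_{i=1}^n$ and the test sample $(\mathbf Y,\mathbf z)$ are generated i.i.d. from $p(\mathbf Y,\mathbf z)$. Let $$\hat\gamma(\mathcal D^{\rm cal})=\sup\left\{\gamma\in[0,\infty):\ \frac{n}{n+1}\,\overline{\mathrm{FNR}}(\gamma\mid\mathcal D^{\rm cal})+\frac{1}{n+1}\le\alpha\right\}.$$ Then for every $\alpha\in[0,1]$, $$\mathbb{E}\big[\mathrm{FNR}\big(\hat\gamma(\mathcal D^{\rm cal});\mathbf Y,\mathbf z\big)\big]\le\alpha,$$ where the expectation is over the joint distribution of the calibration samples and the test sample.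
   Context: A spectral band is divided into $M$ subbands. The vector $\mathbf z=(z_1,\dots,z_M)\in\{0,1\}^M$ records the true occupancy ($z_m=1$ if subband $m$ is occupied, $z_m=0$ if idle), and $\mathbf Y\in\mathbb{R}^{P\times N_s}$ is the matrix of received samples. A feature extractor assigns to $\mathbf Y$ one nonnegative feature $f_m(\mathbf Y)$ per subband; it is fixed, i.e. it does not depend on the calibration or test samples. Given a common threshold $\gamma\in[0,\infty]$, the estimated occupancy is $\hat z_m(\gamma;\mathbf Y)=\mathbf 1\{f_m(\mathbf Y)\ge\gamma\}$ for $m=1,\dots,M$ (so $\hat z_m(\infty;\mathbf Y)=0$). The false negative rate at threshold $\gamma$ on a pair $(\mathbf Y,\mathbf z)$ is $$\mathrm{FNR}(\gamma;\mathbf Y,\mathbf z)=\frac{\sum_{m=1}^M\big(1-\hat z_m(\gamma;\mathbf Y)\big)z_m}{\sum_{m=1}^M z_m},$$ with the convention that it equals $0$ when $\sum_{m=1}^M z_m=0$. The empirical average FNR over the calibration set is $$\overline{\mathrm{FNR}}(\gamma\mid\mathcal D^{\rm cal})=\frac1n\sum_{i=1}^n\mathrm{FNR}(\gamma;\mathbf Y_i^{\rm cal},\mathbf z_i^{\rm cal}).$$ The supremum defining $\hat\gamma(\mathcal D^{\rm cal})$ is taken in $[0,\infty]$, so the supremum of the empty set is $0$ and an unbounded set has supremum $\infty$. *)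

theory Defs
  imports "HOL-Probability.Probability"
begin

text \<open>
  A \<open>P \<times> N\<^sub>s\<close> real matrix is an element of \<^typ>\<open>real ^ 's ^ 'p\<close> with
  \<open>P = CARD('p)\<close> and \<open>N\<^sub>s = CARD('s)\<close>; the number of subbands is \<open>M = CARD('m)\<close>.
\<close>

type_synonym ('p, 's, 'm) sample = "(real ^ 's ^ 'p) \<times> (real ^ 'm)"

definition occupancies :: "(real ^ 'm) set" where
  "occupancies = {z. \<forall>m. z $ m \<in> {0, 1}}"

definition sample_space :: "('p::finite, 's::finite, 'm::finite) sample measure" where
  "sample_space = borel \<Otimes>\<^sub>M count_space occupancies"

text \<open>
  Thresholds range over \<open>[0, \<infinity>]\<close>, i.e. over \<^typ>\<open>ennreal\<close>. The coercion
  \<^const>\<open>ennreal\<close> truncates negative reals to \<open>0\<close>; it is only meant for nonnegative features.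
\<close>

definition est_occupancy ::
    "(real ^ 's ^ 'p \<Rightarrow> real ^ 'm) \<Rightarrow> ennreal \<Rightarrow> real ^ 's ^ 'p \<Rightarrow> real ^ 'm" where
  "est_occupancy f \<gamma> Y = (\<chi> m. of_bool (ennreal (f Y $ m) \<ge> \<gamma>))"

definition FNR ::
    "(real ^ 's ^ 'p \<Rightarrow> real ^ 'm) \<Rightarrow> ennreal \<Rightarrow> ('p, 's, 'm::finite) sample \<Rightarrow> real" where
  "FNR f \<gamma> = (\<lambda>(Y, z).
     if (\<Sum>m\<in>UNIV. z $ m) = 0 then 0
     else (\<Sum>m\<in>UNIV. (1 - est_occupancy f \<gamma> Y $ m) * z $ m) / (\<Sum>m\<in>UNIV. z $ m))"

text \<open>A calibration set of size \<open>n\<close> is a family \<open>D\<close> of which only \<open>D 1, \<dots>, D n\<close> are used.\<close>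

definition avg_FNR ::
    "(real ^ 's ^ 'p \<Rightarrow> real ^ 'm) \<Rightarrow> nat \<Rightarrow> ennreal \<Rightarrow> (nat \<Rightarrow> ('p, 's, 'm::finite) sample) \<Rightarrow> real" where
  "avg_FNR f n \<gamma> D = 1 / real n * (\<Sum>i=1..n. FNR f \<gamma> (D i))"

text \<open>In \<^typ>\<open>ennreal\<close> the supremum of the empty set is \<open>0\<close> and that of an unbounded set is \<open>\<infinity>\<close>.\<close>

definition crc_threshold ::
    "(real ^ 's ^ 'p \<Rightarrow> real ^ 'm) \<Rightarrow> nat \<Rightarrow> real \<Rightarrow> (nat \<Rightarrow> ('p, 's, 'm::finite) sample) \<Rightarrow> ennreal" where
  "crc_threshold f n \<alpha> D =
     Sup {\<gamma>. \<gamma> < \<infinity> \<and>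
       real n / (real n + 1) * avg_FNR f n \<gamma> D + 1 / (real n + 1) \<le> \<alpha>}"

end

theory Submission
  imports Defs
begin

text \<open>
  The FNR is nondecreasing and left-continuous in the threshold, so the supremum defining a
  threshold is attained. Since the test FNR is at most \<open>1\<close>, the calibrated threshold is dominated
  by the ideal threshold at which the sum of all \<open>n + 1\<close> FNRs, the test sample included, is at most
  \<open>(n + 1) \<alpha>\<close>. The ideal threshold is a symmetric function of the samples, so by exchangeability
  the expected test FNR at it is the expected average of all \<open>n + 1\<close> FNRs, which is at most \<open>\<alpha>\<close>.
\<close>

section \<open>Order, bounds, left-continuity and measurability of the FNR\<close>

lemma space_sample_space: "space sample_space = UNIV \<times> occupancies"
  by (simp add: sample_space_def space_pair_measure)

lemma occupancies_nth: "z \<in> occupancies \<Longrightarrow> 0 \<le> z $ m"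
  unfolding occupancies_def by (auto dest: spec[of _ m])

text \<open>Raising the threshold can only turn estimated occupancies off, so each summand of the
  numerator can only grow, while the denominator stays fixed.\<close>

lemma FNR_mono:
  assumes "s \<in> space sample_space" "\<gamma> \<le> \<gamma>'"
  shows "FNR f \<gamma> s \<le> FNR f \<gamma>' s"
proof -
  obtain Y z where s: "s = (Y, z)" by (cases s)
  have z: "0 \<le> z $ m" for m
    using assms(1) occupancies_nth by (auto simp: space_sample_space s)
  show ?thesis
    using assms(2) unfolding s FNR_def est_occupancy_def
    by (auto intro!: divide_right_mono sum_mono mult_right_mono sum_nonneg z)
qed

lemma FNR_nonneg:
  assumes "s \<in> space sample_space"
  shows "0 \<le> FNR f \<gamma> s"
proof -
  obtain Y z where s: "s = (Y, z)" by (cases s)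
  have z: "0 \<le> z $ m" for m
    using assms occupancies_nth by (auto simp: space_sample_space s)
  show ?thesis
    unfolding s FNR_def est_occupancy_def
    by (auto intro!: divide_nonneg_nonneg sum_nonneg mult_nonneg_nonneg z)
qed

lemma FNR_le_1:
  assumes "s \<in> space sample_space"
  shows "FNR f \<gamma> s \<le> 1"
proof -
  obtain Y z where s: "s = (Y, z)" by (cases s)
  have z: "0 \<le> z $ m" for m
    using assms occupancies_nth by (auto simp: space_sample_space s)
  have "(\<Sum>m\<in>UNIV. (1 - est_occupancy f \<gamma> Y $ m) * z $ m) \<le> (\<Sum>m\<in>UNIV. z $ m)"
    by (intro sum_mono mult_left_le_one_le z) (auto simp: est_occupancy_def)
  moreover have "0 \<le> (\<Sum>m\<in>UNIV. z $ m)"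
    by (intro sum_nonneg z)
  ultimately show ?thesis
    unfolding s FNR_def by (auto simp: divide_le_eq)
qed

lemma FNR_0 [simp]: "FNR f 0 s = 0"
  by (cases s) (simp add: FNR_def est_occupancy_def)

text \<open>Left-continuity: the FNR is a step function, so it is constant just below each threshold.\<close>

lemma FNR_left_constant:
  fixes D :: "'i \<Rightarrow> ('p::finite, 's::finite, 'm::finite) sample"
  assumes "finite I" "0 < t"
  obtains s where "s < t" "\<And>i. i \<in> I \<Longrightarrow> FNR f s (D i) = FNR f t (D i)"
proof -
  \<comment> \<open>\<open>V\<close> collects the finitely many feature values strictly below
    \<open>t\<close>; inserting 0 makes \<open>Max V\<close> meaningful. For \<open>s\<close>
    strictly between \<open>Max V\<close> and \<open>t\<close>, no feature value lies in
    \<open>[s, t)\<close>, so \<open>s\<close> and \<open>t\<close> give the same estimates.\<close>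
  define V where "V = insert 0 {v \<in> (\<lambda>(i, m). ennreal (f (fst (D i)) $ m)) ` (I \<times> UNIV). v < t}"
  have V: "finite V" "V \<noteq> {}" and "\<forall>v\<in>V. v < t"
    using assms by (auto simp: V_def)
  then have "Max V < t"
    by simp
  then obtain s where s: "Max V < s" "s < t"
    using dense by blast
  have iff: "s \<le> ennreal (f (fst (D i)) $ m) \<longleftrightarrow> t \<le> ennreal (f (fst (D i)) $ m)" if "i \<in> I" for i m
  proof (rule ccontr)
    assume "\<not> ?thesis"
    with s have "s \<le> ennreal (f (fst (D i)) $ m)" "ennreal (f (fst (D i)) $ m) < t"
      by auto
    with \<open>i \<in> I\<close> have "ennreal (f (fst (D i)) $ m) \<in> V"
      by (force simp: V_def)
    with V have "ennreal (f (fst (D i)) $ m) \<le> Max V"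
      by simp
    with s \<open>s \<le> _\<close> show False
      by auto
  qed
  have "FNR f s (D i) = FNR f t (D i)" if "i \<in> I" for i
    using iff[OF that] by (simp add: FNR_def est_occupancy_def split_beta)
  with s show ?thesis
    using that by blast
qed

text \<open>Joint measurability in threshold and sample is required because the threshold will
  itself be random.\<close>

lemma measurable_FNR [measurable]:
  assumes [measurable]: "f \<in> borel_measurable borel"
  shows "(\<lambda>(\<gamma>, s). FNR f \<gamma> s) \<in> borel_measurable (borel \<Otimes>\<^sub>M sample_space)"
proof -
  have "(\<lambda>v :: real ^ 'm. v $ m) \<in> borel_measurable borel" for m :: "'m::finite"
    by (intro borel_measurable_continuous_onI continuous_intros)
  note [measurable] = measurable_compose[OF _ this]
  \<comment> \<open>The occupancy component carries a discrete sigma-algebra, from which every map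
    is measurable.\<close>
  have [measurable]: "(\<lambda>x. snd (snd x) $ m) \<in>
      borel_measurable (borel \<Otimes>\<^sub>M borel \<Otimes>\<^sub>M count_space occupancies)" for m
    by (rule measurable_compose[where N = "count_space occupancies"]) measurable
  show ?thesis
    unfolding FNR_def est_occupancy_def sample_space_def split_beta vec_lambda_beta of_bool_def
    by measurable
qed

section \<open>Thresholds as suprema: attainment, measurability and comparison\<close>

text \<open>A common form for the calibrated and the ideal threshold: the index set and the budget
  \<open>c\<close> vary, and the FNRs are summed rather than averaged.\<close>

definition sup_threshold ::
    "(real ^ 's ^ 'p \<Rightarrow> real ^ 'm) \<Rightarrow> 'i set \<Rightarrow> real \<Rightarrow> ('i \<Rightarrow> ('p, 's, 'm::finite) sample) \<Rightarrow> ennreal"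
  where "sup_threshold f I c D = Sup {\<gamma>. (\<Sum>i\<in>I. FNR f \<gamma> (D i)) \<le> c}"

text \<open>The feasible thresholds form an interval from 0 that contains its supremum. The
  condition \<open>0 \<le> c\<close> makes 0 feasible; otherwise the empty supremum 0 would break
  the equivalence at \<open>t = 0\<close>.\<close>

lemma le_sup_threshold_iff:
  assumes "finite I" and D: "\<And>i. i \<in> I \<Longrightarrow> D i \<in> space sample_space" and "0 \<le> c"
  shows "t \<le> sup_threshold f I c D \<longleftrightarrow> (\<Sum>i\<in>I. FNR f t (D i)) \<le> c"
proof
  assume t: "t \<le> sup_threshold f I c D"
  show "(\<Sum>i\<in>I. FNR f t (D i)) \<le> c"
  proof (cases "t = 0")
    case True
    with \<open>0 \<le> c\<close> show ?thesis by simp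
  next
    case False
    then obtain s where s: "s < t" "\<And>i. i \<in> I \<Longrightarrow> FNR f s (D i) = FNR f t (D i)"
      using FNR_left_constant[OF \<open>finite I\<close>, of t f D] by (auto simp: zero_less_iff_neq_zero)
    from s(1) t have "s < sup_threshold f I c D"
      by simp
    then obtain \<gamma> where \<gamma>: "s < \<gamma>" "(\<Sum>i\<in>I. FNR f \<gamma> (D i)) \<le> c"
      by (auto simp: sup_threshold_def less_Sup_iff)
    \<comment> \<open>Possibly \<open>\<gamma> < t\<close>, so monotonicity is applied to
      \<open>s < \<gamma>\<close>, where the FNRs at \<open>s\<close> equal those at
      \<open>t\<close>.\<close>
    have "(\<Sum>i\<in>I. FNR f t (D i)) \<le> (\<Sum>i\<in>I. FNR f \<gamma> (D i))"
      using \<gamma>(1) by (intro sum_mono) (simp add: s(2)[symmetric] FNR_mono D)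
    with \<gamma>(2) show ?thesis by simp
  qed
qed (simp add: sup_threshold_def Sup_upper)

text \<open>Covers the calibration budget when \<open>\<alpha> < 1 / (n + 1)\<close>: no threshold
  is feasible.\<close>

lemma sup_threshold_neg:
  assumes D: "\<And>i. i \<in> I \<Longrightarrow> D i \<in> space sample_space" and "c < 0"
  shows "sup_threshold f I c D = 0"
proof -
  have "0 \<le> (\<Sum>i\<in>I. FNR f \<gamma> (D i))" for \<gamma>
    by (intro sum_nonneg FNR_nonneg D)
  with \<open>c < 0\<close> have "{\<gamma>. (\<Sum>i\<in>I. FNR f \<gamma> (D i)) \<le> c} = {}"
    by (metis (mono_tags, lifting) Collect_empty_eq linorder_not_le order_trans)
  then show ?thesis
    by (simp add: sup_threshold_def bot_ennreal)
qed

text \<open>For \<open>0 \<le> c\<close>, attainment turns each superlevel set of the threshold into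
  a sublevel set of a finite sum of measurable FNRs.\<close>

lemma measurable_sup_threshold:
  assumes [measurable]: "f \<in> borel_measurable borel" and "finite I"
  shows "sup_threshold f I c \<in> borel_measurable (PiM I (\<lambda>_. sample_space))"
proof (cases "0 \<le> c")
  case True
  have [measurable]: "FNR f t \<in> borel_measurable sample_space" for t
    using measurable_Pair2[OF measurable_FNR[OF assms(1)], of t] by simp
  show ?thesis
  proof (rule borel_measurableI_ge)
    fix t
    have "{D \<in> space (PiM I (\<lambda>_. sample_space)). t \<le> sup_threshold f I c D} =
      {D \<in> space (PiM I (\<lambda>_. sample_space)). (\<Sum>i\<in>I. FNR f t (D i)) \<le> c}"
      using True \<open>finite I\<close> by (intro Collect_cong conj_cong refl le_sup_threshold_iff) (auto simp: space_PiM)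
    also have "\<dots> \<in> sets (PiM I (\<lambda>_. sample_space))"
      by measurable
    finally show "{D \<in> space (PiM I (\<lambda>_. sample_space)). t \<le> sup_threshold f I c D}
      \<in> sets (PiM I (\<lambda>_. sample_space))" .
  qed
next
  case False
  have "sup_threshold f I c D = 0" if "D \<in> space (PiM I (\<lambda>_. sample_space))" for D
    using that False by (intro sup_threshold_neg) (auto simp: space_PiM)
  then show ?thesis
    by (subst measurable_cong[where g = "\<lambda>_. 0"]) auto
qed

text \<open>Adding \<open>\<infinity>\<close> to the range of the supremum in \<^const>\<open>crc_threshold\<close> does not change it.\<close>

lemma crc_threshold_eq:
  assumes "n \<ge> 1" and D: "\<And>i. i \<in> {1..n} \<Longrightarrow> D i \<in> space sample_space"
  shows "crc_threshold f n \<alpha> D = sup_threshold f {1..n} ((real n + 1) * \<alpha> - 1) D"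
proof -
  have iff: "real n / (real n + 1) * avg_FNR f n \<gamma> D + 1 / (real n + 1) \<le> \<alpha> \<longleftrightarrow>
      (\<Sum>i=1..n. FNR f \<gamma> (D i)) \<le> (real n + 1) * \<alpha> - 1" for \<gamma>
  proof -
    have "real n / (real n + 1) * avg_FNR f n \<gamma> D + 1 / (real n + 1) =
        ((\<Sum>i=1..n. FNR f \<gamma> (D i)) + 1) / (real n + 1)"
      using \<open>n \<ge> 1\<close> by (simp add: avg_FNR_def add_divide_distrib)
    then show ?thesis
      by (simp add: divide_le_eq algebra_simps)
  qed
  show ?thesis
    unfolding crc_threshold_def sup_threshold_def iff
  proof (rule antisym[OF Sup_subset_mono Sup_least])
    fix \<gamma> assume \<gamma>: "\<gamma> \<in> {\<gamma>. (\<Sum>i=1..n. FNR f \<gamma> (D i)) \<le> (real n + 1) * \<alpha> - 1}"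
    show "\<gamma> \<le> Sup {\<gamma>. \<gamma> < \<infinity> \<and> (\<Sum>i=1..n. FNR f \<gamma> (D i)) \<le> (real n + 1) * \<alpha> - 1}"
    \<comment> \<open>Every \<open>x < \<gamma>\<close> is finite and, by monotonicity, feasible;
      this also handles \<open>\<gamma> = \<infinity>\<close>.\<close>
    proof (rule dense_le, rule Sup_upper)
      fix x assume "x < \<gamma>"
      then have "(\<Sum>i=1..n. FNR f x (D i)) \<le> (\<Sum>i=1..n. FNR f \<gamma> (D i))"
        by (intro sum_mono FNR_mono D) auto
      with \<gamma> \<open>x < \<gamma>\<close> show "x \<in> {\<gamma>. \<gamma> < \<infinity> \<and> (\<Sum>i=1..n. FNR f \<gamma> (D i)) \<le> (real n + 1) * \<alpha> - 1}"
        using order_less_le_trans[OF \<open>x < \<gamma>\<close>, of \<infinity>] by auto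
    qed
  qed auto
qed

text \<open>The test FNR adds at most 1 to the sum, exactly the 1 withheld from the calibration
  budget, so thresholds feasible for calibration stay feasible for all \<open>n + 1\<close>
  samples.\<close>

lemma crc_threshold_le_sup_threshold:
  assumes "n \<ge> 1" "0 \<le> \<alpha>" and D: "\<And>i. i \<in> {1..n + 1} \<Longrightarrow> D i \<in> space sample_space"
  shows "crc_threshold f n \<alpha> D \<le> sup_threshold f {1..n + 1} ((real n + 1) * \<alpha>) D"
proof -
  have "(\<Sum>i=1..n + 1. FNR f \<gamma> (D i)) \<le> (\<Sum>i=1..n. FNR f \<gamma> (D i)) + 1" for \<gamma>
    using FNR_le_1[of "D (n + 1)" f \<gamma>] D by simp
  then have "sup_threshold f {1..n} ((real n + 1) * \<alpha> - 1) D
      \<le> sup_threshold f {1..n + 1} ((real n + 1) * \<alpha>) D"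
    unfolding sup_threshold_def by (intro Sup_subset_mono) (smt (verit) Collect_mono)
  with crc_threshold_eq[of n D f \<alpha>] assms show ?thesis
    by simp
qed

lemma sup_threshold_restrict: "sup_threshold f I c (restrict D I) = sup_threshold f I c D"
  by (simp add: sup_threshold_def)

lemma sup_threshold_permutes:
  assumes "\<tau> permutes I"
  shows "sup_threshold f I c (\<lambda>i. D (\<tau> i)) = sup_threshold f I c D"
  unfolding sup_threshold_def
  using sum.permute[OF assms, of "\<lambda>i. FNR f \<gamma> (D i)" for \<gamma>] by (simp add: comp_def)

section \<open>Exchangeability of i.i.d. samples\<close>

text \<open>Independence makes the joint law a product, and a product of equal factors is invariant
  under permuting coordinates.\<close>

lemma (in prob_space) iid_distr_permutes:
  assumes indep: "indep_vars (\<lambda>_. N) X I" and ident: "\<And>i. i \<in> I \<Longrightarrow> distr M N (X i) = p"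
    and "\<tau> permutes I" "I \<noteq> {}"
  shows "distr M (PiM I (\<lambda>_. N)) (\<lambda>\<omega>. \<lambda>i\<in>I. X (\<tau> i) \<omega>) = distr M (PiM I (\<lambda>_. N)) (\<lambda>\<omega>. \<lambda>i\<in>I. X i \<omega>)"
proof -
  have X: "X i \<in> M \<rightarrow>\<^sub>M N" if "i \<in> I" for i
    using indep that by (auto simp: indep_vars_def)
  obtain i\<^sub>0 where i\<^sub>0: "i\<^sub>0 \<in> I"
    using \<open>I \<noteq> {}\<close> by blast
  then have p: "prob_space p" "sets p = sets N"
    using prob_space_distr[OF X[OF i\<^sub>0]] by (auto simp flip: ident)
  have sets: "sets (PiM I (\<lambda>_. p)) = sets (PiM I (\<lambda>_. N))"
    by (intro sets_PiM_cong refl p(2))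
  have \<tau>: "inj_on \<tau> I" "\<tau> \<in> I \<rightarrow> I"
    using permutes_inj_on[OF \<open>\<tau> permutes I\<close>] permutes_in_image[OF \<open>\<tau> permutes I\<close>] by auto
  have joint: "(\<lambda>\<omega>. \<lambda>i\<in>I. X i \<omega>) \<in> M \<rightarrow>\<^sub>M PiM I (\<lambda>_. N)"
    by (intro measurable_restrict X)
  have perm: "(\<lambda>D. \<lambda>i\<in>I. D (\<tau> i)) \<in> PiM I (\<lambda>_. N) \<rightarrow>\<^sub>M PiM I (\<lambda>_. N)"
    using \<tau>(2) by (intro measurable_restrict measurable_component_singleton) auto
  have "distr M (PiM I (\<lambda>_. N)) (\<lambda>\<omega>. \<lambda>i\<in>I. X i \<omega>) = PiM I (\<lambda>i. distr M N (X i))"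
    using indep \<open>I \<noteq> {}\<close> X by (intro indep_vars_iff_distr_eq_PiM'[THEN iffD1])
  also have "\<dots> = PiM I (\<lambda>_. p)"
    by (intro PiM_cong refl ident)
  finally have law: "distr M (PiM I (\<lambda>_. N)) (\<lambda>\<omega>. \<lambda>i\<in>I. X i \<omega>) = PiM I (\<lambda>_. p)" .
  have "distr M (PiM I (\<lambda>_. N)) (\<lambda>\<omega>. \<lambda>i\<in>I. X (\<tau> i) \<omega>) =
      distr M (PiM I (\<lambda>_. N)) ((\<lambda>D. \<lambda>i\<in>I. D (\<tau> i)) \<circ> (\<lambda>\<omega>. \<lambda>i\<in>I. X i \<omega>))"
    using \<tau>(2) by (intro distr_cong) (auto simp: fun_eq_iff)
  also have "\<dots> = distr (PiM I (\<lambda>_. p)) (PiM I (\<lambda>_. N)) (\<lambda>D. \<lambda>i\<in>I. D (\<tau> i))"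
    unfolding law[symmetric] by (rule distr_distr[OF perm joint, symmetric])
  \<comment> \<open>The target changes only in name, as \<open>p\<close> and \<open>N\<close> have
    the same measurable sets; the reindexing rule for products then applies.\<close>
  also have "\<dots> = distr (PiM I (\<lambda>_. p)) (PiM I (\<lambda>_. p)) (\<lambda>D. \<lambda>i\<in>I. D (\<tau> i))"
    by (intro distr_cong refl sets[symmetric])
  also have "\<dots> = PiM I (\<lambda>_. p)"
    using distr_PiM_reindex[of I "\<lambda>_. p" \<tau> I] p(1) \<tau> by simp
  finally show ?thesis
    using law by simp
qed

section \<open>The bound at the ideal threshold and its transfer to the calibrated one\<close>

theorem theorem1:
  fixes p :: "('p::finite, 's::finite, 'm::finite) sample measure"
    and f :: "real ^ 's ^ 'p \<Rightarrow> real ^ 'm"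
    and \<Omega> :: "'w measure"
    and X :: "nat \<Rightarrow> 'w \<Rightarrow> ('p, 's, 'm) sample"
    and n :: nat and \<alpha> :: real
  assumes n: "n \<ge> 1"
    and p: "prob_space p" "sets p = sets sample_space"
    and f: "f \<in> borel_measurable borel" "\<And>Y m. f Y $ m \<ge> 0"
    and \<Omega>: "prob_space \<Omega>"
    and indep: "prob_space.indep_vars \<Omega> (\<lambda>_. sample_space) X {1..n + 1}"
    and ident: "\<And>i. i \<in> {1..n + 1} \<Longrightarrow> distr \<Omega> sample_space (X i) = p"
    and \<alpha>: "0 \<le> \<alpha>" "\<alpha> \<le> 1"
  shows "integrable \<Omega> (\<lambda>\<omega>. FNR f (crc_threshold f n \<alpha> (\<lambda>i. X i \<omega>)) (X (n + 1) \<omega>)) \<and>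
    (\<integral>\<omega>. FNR f (crc_threshold f n \<alpha> (\<lambda>i. X i \<omega>)) (X (n + 1) \<omega>) \<partial>\<Omega>) \<le> \<alpha>"
proof -
  interpret prob_space \<Omega> by (rule \<Omega>)
  note [measurable] = f(1)
  define I where "I = {1..n + 1}"
  define c where "c = (real n + 1) * \<alpha>"
  have I: "finite I" "I \<noteq> {}" "card I = n + 1" "n + 1 \<in> I"
    by (auto simp: I_def)
  have X [measurable]: "X i \<in> \<Omega> \<rightarrow>\<^sub>M sample_space" if "i \<in> I" for i
    using indep that unfolding I_def indep_vars_def by auto
  have X_space: "X i \<omega> \<in> space sample_space" if "i \<in> I" "\<omega> \<in> space \<Omega>" for i \<omega>
    using X that by (meson measurable_space)
  have joint [measurable]: "(\<lambda>\<omega>. \<lambda>i\<in>J. X i \<omega>) \<in> \<Omega> \<rightarrow>\<^sub>M PiM J (\<lambda>_. sample_space)" if "J \<subseteq> I" for J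
    using that by (intro measurable_restrict X) auto
  have T_meas: "(\<lambda>\<omega>. sup_threshold f J d (\<lambda>i. X i \<omega>)) \<in> borel_measurable \<Omega>" if "J \<subseteq> I" for J d
    using measurable_compose[OF joint[OF that] measurable_sup_threshold[OF f(1), of J d]]
      finite_subset[OF that I(1)] by (simp add: sup_threshold_restrict)
  \<comment> \<open>The random threshold is kept arbitrary to serve both the ideal and the
    calibrated one.\<close>
  have integrable_FNR: "integrable \<Omega> (\<lambda>\<omega>. FNR f (T \<omega>) (X i \<omega>))"
    if T: "T \<in> borel_measurable \<Omega>" and i: "i \<in> I" for T i
  proof (rule integrable_const_bound[where B = 1])
    show "AE \<omega> in \<Omega>. norm (FNR f (T \<omega>) (X i \<omega>)) \<le> 1"
      using X_space[OF i] by (intro AE_I2) (simp add: FNR_nonneg FNR_le_1)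
    show "(\<lambda>\<omega>. FNR f (T \<omega>) (X i \<omega>)) \<in> borel_measurable \<Omega>"
      using measurable_compose[OF measurable_Pair[OF T X[OF i]] measurable_FNR[OF f(1)]] by simp
  qed
  define T where "T = (\<lambda>\<omega>. sup_threshold f I c (\<lambda>i. X i \<omega>))"
  have T: "T \<in> borel_measurable \<Omega>"
    unfolding T_def by (rule T_meas) simp
  have crc: "(\<lambda>\<omega>. crc_threshold f n \<alpha> (\<lambda>i. X i \<omega>)) \<in> borel_measurable \<Omega>"
    using T_meas[of "{1..n}"] X_space n
    by (subst measurable_cong[OF crc_threshold_eq]) (auto simp: I_def)

  have exch: "(\<integral>\<omega>. FNR f (T \<omega>) (X j \<omega>) \<partial>\<Omega>) = (\<integral>\<omega>. FNR f (T \<omega>) (X (n + 1) \<omega>) \<partial>\<Omega>)" if j: "j \<in> I" for j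
  proof -
    \<comment> \<open>Swapping \<open>j\<close> with the test index \<open>n + 1\<close> puts
      \<open>X j\<close> in the test position and leaves the ideal threshold unchanged.\<close>
    define \<tau> where "\<tau> = Transposition.transpose j (n + 1)"
    have \<tau>: "\<tau> permutes I"
      unfolding \<tau>_def using j I by (intro permutes_swap_id)
    define H where "H = (\<lambda>D. FNR f (sup_threshold f I c D) (D (n + 1)))"
    have H: "H \<in> borel_measurable (PiM I (\<lambda>_. sample_space))"
      using measurable_compose[OF measurable_Pair[OF measurable_sup_threshold[OF f(1) I(1), of c]
            measurable_component_singleton[OF I(4)]] measurable_FNR[OF f(1)]]
      by (simp add: H_def)
    have perm: "(\<lambda>\<omega>. \<lambda>i\<in>I. X (\<tau> i) \<omega>) \<in> \<Omega> \<rightarrow>\<^sub>M PiM I (\<lambda>_. sample_space)"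
      using permutes_in_image[OF \<tau>] by (intro measurable_restrict X) simp
    have "(\<integral>\<omega>. FNR f (T \<omega>) (X j \<omega>) \<partial>\<Omega>) = (\<integral>\<omega>. H (\<lambda>i\<in>I. X (\<tau> i) \<omega>) \<partial>\<Omega>)"
      using sup_threshold_permutes[OF \<tau>, of f c "\<lambda>i. X i \<omega>" for \<omega>] I(4)
      by (simp add: H_def T_def sup_threshold_restrict) (simp add: \<tau>_def)
    also have "\<dots> = (\<integral>D. H D \<partial>distr \<Omega> (PiM I (\<lambda>_. sample_space)) (\<lambda>\<omega>. \<lambda>i\<in>I. X (\<tau> i) \<omega>))"
      by (rule integral_distr[OF perm H, symmetric])
    also have "\<dots> = (\<integral>D. H D \<partial>distr \<Omega> (PiM I (\<lambda>_. sample_space)) (\<lambda>\<omega>. \<lambda>i\<in>I. X i \<omega>))"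
      using indep ident \<tau> I(2) by (subst iid_distr_permutes[where p = p]) (auto simp: I_def)
    also have "\<dots> = (\<integral>\<omega>. H (\<lambda>i\<in>I. X i \<omega>) \<partial>\<Omega>)"
      by (rule integral_distr[OF joint H]) simp
    also have "\<dots> = (\<integral>\<omega>. FNR f (T \<omega>) (X (n + 1) \<omega>) \<partial>\<Omega>)"
      using I(4) by (simp add: H_def T_def sup_threshold_restrict)
    finally show ?thesis .
  qed
  have "(real n + 1) * (\<integral>\<omega>. FNR f (T \<omega>) (X (n + 1) \<omega>) \<partial>\<Omega>) = (\<Sum>j\<in>I. \<integral>\<omega>. FNR f (T \<omega>) (X j \<omega>) \<partial>\<Omega>)"
    using I(3) by (simp add: exch algebra_simps)
  also have "\<dots> = (\<integral>\<omega>. (\<Sum>j\<in>I. FNR f (T \<omega>) (X j \<omega>)) \<partial>\<Omega>)"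
    by (intro Bochner_Integration.integral_sum[symmetric] integrable_FNR T)
  also have "\<dots> \<le> c"
  proof (rule integral_le_const)
    show "integrable \<Omega> (\<lambda>\<omega>. \<Sum>j\<in>I. FNR f (T \<omega>) (X j \<omega>))"
      by (intro Bochner_Integration.integrable_sum integrable_FNR T)
    \<comment> \<open>The supremum \<open>T \<omega>\<close> is itself feasible, since
      \<open>c \<ge> 0\<close>.\<close>
    show "AE \<omega> in \<Omega>. (\<Sum>j\<in>I. FNR f (T \<omega>) (X j \<omega>)) \<le> c"
      unfolding T_def using I(1) \<alpha>(1)
      by (intro AE_I2 le_sup_threshold_iff[THEN iffD1]) (auto simp: X_space c_def)
  qed
  finally have ideal: "(\<integral>\<omega>. FNR f (T \<omega>) (X (n + 1) \<omega>) \<partial>\<Omega>) \<le> \<alpha>"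
    by (simp add: c_def)
  \<comment> \<open>The calibrated threshold is smaller pointwise, so by monotonicity its test FNR
    is smaller too.\<close>
  have "crc_threshold f n \<alpha> (\<lambda>i. X i \<omega>) \<le> T \<omega>" if "\<omega> \<in> space \<Omega>" for \<omega>
    unfolding T_def c_def I_def using n \<alpha>(1) X_space that
    by (intro crc_threshold_le_sup_threshold) (auto simp: I_def)
  then have "(\<integral>\<omega>. FNR f (crc_threshold f n \<alpha> (\<lambda>i. X i \<omega>)) (X (n + 1) \<omega>) \<partial>\<Omega>)
      \<le> (\<integral>\<omega>. FNR f (T \<omega>) (X (n + 1) \<omega>) \<partial>\<Omega>)"
    by (intro integral_mono integrable_FNR crc T I(4) FNR_mono X_space) auto
  with ideal integrable_FNR[OF crc I(4)] show ?thesis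
    by simp
qed

end
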